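(* Let $[u]$ be any nonzero entire function satisfying the Riemann relation, let $\Omega\subset\mathbb{C}$ be its zero set, let $\delta,\kappa\in\mathbb{C}\setminus\Omega$, $v\in\mathbb{C}$, and let $m,n$ be positive integers. Let $x=(x_1,\dots,x_m)$, $y=(y_1,\dots,y_n)$. (1) Let $G(u|\delta)$ be a nonzero meromorphic function with $G(u+\delta|\delta)=c\,[u]\,G(u|\delta)$ for some nonzero constant $c$, and put $$\Phi_A(x;y|\delta,\kappa)=\prod_{j=1}^{m}\prod_{l=1}^{n}\frac{G(x_j+y_l+v-\kappa|\delta)}{G(x_j+y_l+v|\delta)} .$$ If $m=n$, then $$D_x^{(\delta,\kappa)}\Phi_A(x;y|\delta,\kappa)=D_y^{(\delta,\kappa)}\Phi_A(x;y|\delta,\kappa).$$ (2) Put $\Psi_A(x;y)=\prod_{j=1}^{m}\prod_{l=1}^{n}[x_j-y_l+v]$. Under the balancing condition $m\kappa+n\delta=0$, $$[\kappa]\,D_x^{(\delta,\kappa)}\Psi_A(x;y)+[\delta]\,D_y^{(\kappa,\delta)}\Psi_A(x;y)=0 .$$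
   Context: The Riemann relation for an entire function $[u]$ is $$[x+u][x-u][y+v][y-v]-[x+v][x-v][y+u][y-u]=[x+y][x-y][u+v][u-v]\qquad(x,y,u,v\in\mathbb{C}).$$ Such a nonzero function is odd and its zero set $\Omega$ is an additive subgroup of $\mathbb{C}$. For $N$ variables $x=(x_1,\dots,x_N)$, the Ruijsenaars difference operator of type $A$ acting on meromorphic functions of $x$ is $$D_x^{(\delta,\kappa)}=\sum_{i=1}^{N}\Big(\prod_{1\le j\le N,\,j\ne i}\frac{[x_i-x_j+\kappa]}{[x_i-x_j]}\Big)T_{x_i}^{\delta},\qquad T_{x_i}^{\delta}f(x_1,\dots,x_N)=f(x_1,\dots,x_i+\delta,\dots,x_N).$$ Operators with subscript $x$ act on the $m$ variables $x$ (so $N=m$), operators with subscript $y$ act on the $n$ variables $y$ (so $N=n$). In $D_y^{(\kappa,\delta)}$ the roles of $\delta$ and $\kappa$ are exchanged: the shift is by $\kappa$ and the coefficients involve $[y_k-y_l+\delta]/[y_k-y_l]$. *)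

theory Defs
  imports "HOL-Complex_Analysis.Complex_Analysis"
begin

definition riemann_relation :: "(complex \<Rightarrow> complex) \<Rightarrow> bool" where
  "riemann_relation s \<longleftrightarrow> (\<forall>x y u v.
     s (x + u) * s (x - u) * s (y + v) * s (y - v) - s (x + v) * s (x - v) * s (y + u) * s (y - u)
       = s (x + y) * s (x - y) * s (u + v) * s (u - v))"

definition shift_op ::
    "complex \<Rightarrow> 'n \<Rightarrow> (complex ^ 'n \<Rightarrow> complex) \<Rightarrow> complex ^ 'n \<Rightarrow> complex" where
  "shift_op \<delta> i f x = f (\<chi> j. if j = i then x $ j + \<delta> else x $ j)"

(* The number N of variables is CARD('n). *)
definition ruijsenaars_op ::
    "(complex \<Rightarrow> complex) \<Rightarrow> complex \<Rightarrow> complex \<Rightarrow>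
     (complex ^ 'n \<Rightarrow> complex) \<Rightarrow> complex ^ 'n \<Rightarrow> complex" where
  "ruijsenaars_op s \<delta> \<kappa> f x =
     (\<Sum>i\<in>UNIV. (\<Prod>j\<in>UNIV - {i}. s (x $ i - x $ j + \<kappa>) / s (x $ i - x $ j)) * shift_op \<delta> i f x)"

definition Phi_A ::
    "(complex \<Rightarrow> complex) \<Rightarrow> complex \<Rightarrow> complex \<Rightarrow> complex ^ 'm \<Rightarrow> complex ^ 'n \<Rightarrow> complex" where
  "Phi_A G v \<kappa> x y =
     (\<Prod>j\<in>UNIV. \<Prod>l\<in>UNIV. G (x $ j + y $ l + v - \<kappa>) / G (x $ j + y $ l + v))"

definition Psi_A ::
    "(complex \<Rightarrow> complex) \<Rightarrow> complex \<Rightarrow> complex ^ 'm \<Rightarrow> complex ^ 'n \<Rightarrow> complex" where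
  "Psi_A s v x y = (\<Prod>j\<in>UNIV. \<Prod>l\<in>UNIV. s (x $ j - y $ l + v))"

(* Equality of meromorphic functions of several variables: the expressions F and H agree at
   every point of R, where R is open and dense and has to be chosen so that neither a division
   by zero nor an evaluation at a pole occurs in F and H on R; by continuity the choice of such
   an R does not matter. *)
definition meromorphic_eq_on :: "'a::topological_space set \<Rightarrow> ('a \<Rightarrow> complex) \<Rightarrow> ('a \<Rightarrow> complex) \<Rightarrow> bool"
  where "meromorphic_eq_on R F H \<longleftrightarrow> open R \<and> closure R = UNIV \<and> (\<forall>z\<in>R. F z = H z)"

definition off_diagonals ::
    "(complex \<Rightarrow> complex) \<Rightarrow> ((complex ^ 'm) \<times> (complex ^ 'n)) set" where
  "off_diagonals s = {(x, y).
     (\<forall>i j. i \<noteq> j \<longrightarrow> s (x $ i - x $ j) \<noteq> 0) \<and> (\<forall>k l. k \<noteq> l \<longrightarrow> s (y $ k - y $ l) \<noteq> 0)}"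

(* The values w and w + \<delta> below are the arguments at which G is evaluated in the
   denominators of Phi_A and of its \<delta>-shifts; w - \<kappa> are those in the numerators. *)
definition Phi_A_regular ::
    "(complex \<Rightarrow> complex) \<Rightarrow> complex \<Rightarrow> complex \<Rightarrow> complex \<Rightarrow>
     ((complex ^ 'm) \<times> (complex ^ 'n)) set" where
  "Phi_A_regular G v \<delta> \<kappa> = {(x, y).
     \<forall>j l. \<forall>w \<in> {x $ j + y $ l + v, x $ j + y $ l + v + \<delta>}.
       G analytic_on {w, w - \<kappa>} \<and> G w \<noteq> 0}"

end

theory Submission
  imports Defs
begin

text \<open>
Both identities are instances of one partial fraction formula (\<open>partial_fraction\<close>): for an entire
solution \<open>s\<close> of the Riemann relation, points \<open>u a\<close> whose differences are no zeros of \<open>s\<close>, and points \<open>v a\<close>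
with \<open>\<Sum> u a = \<Sum> v a\<close>,
\<open>\<Sum>\<^sub>a (\<Prod>\<^sub>b s (u a - v b)) / (\<Prod>\<^sub>b\<^sub>\<noteq>\<^sub>a s (u a - u b)) = 0\<close>. For the Weierstrass sigma function
\<open>s\<close> it says that the residues of the elliptic function \<open>\<Prod>\<^sub>b s (t - v b) / s (t - u b)\<close> add up to zero. Here it is derived from
the Riemann relation alone. If \<open>D = \<Sum> u a - \<Sum> v a\<close> is arbitrary, the product is
interpolated by the simple fractions \<open>s (t - u a + D) / s (t - u a)\<close> (\<open>interpolation\<close>). Multiplication
by one more factor \<open>s (t - v x) / s (t - u x)\<close> turns each of these fractions into a combination of two
new ones, which is the Riemann relation with suitable arguments (\<open>three_term\<close>); hence induction on
the number of factors works as long as \<open>s D\<close> can be cancelled, and the excluded values of \<open>D\<close> follow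
by continuity. Choosing \<open>t\<close> as the last of the points gives the balanced formula.

A shift of one variable multiplies \<open>\<Phi>\<close> and \<open>\<Psi>\<close> by a quotient of values of \<open>s\<close>; for \<open>\<Phi>\<close> this is the
functional equation of \<open>G\<close>. Once the kernel function is taken out as a factor, both identities become the
partial fraction formula for \<open>m + n\<close> points: the \<open>x\<^sub>i\<close>, displaced by \<open>\<kappa>\<close>, together with points
\<open>z\<^sub>l\<close>, displaced by \<open>\<delta>\<close> (\<open>two_block_identity\<close>). Its condition \<open>\<Sum> u a = \<Sum> v a\<close> reads
\<open>m \<kappa> + n \<delta> = 0\<close>. For \<open>\<Psi>\<close> one takes \<open>z\<^sub>l = y\<^sub>l - v\<close>, and the zeros of \<open>\<Psi>\<close>, where the quotients are
undefined, are reached by continuity in \<open>v\<close>. For \<open>\<Phi>\<close> one takes \<open>z\<^sub>l = - y\<^sub>l - v\<close> and the displacement \<open>- \<kappa>\<close> in place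
of \<open>\<delta>\<close>, so that the condition becomes \<open>m = n\<close>.

The domains are dense because their complements meet a complex line in a generic direction only
in isolated points.
\<close>

section \<open>Analytic and topological preliminaries\<close>

lemma isCont_eq_if_eventually_eq_at:
  fixes f g :: "complex \<Rightarrow> complex"
  assumes "eventually (\<lambda>z. f z = g z) (at w)" and "isCont f w" and "isCont g w"
  shows "f w = g w"
proof -
  have "(f \<longlongrightarrow> f w) (at w)" and g: "(g \<longlongrightarrow> g w) (at w)"
    using assms by (auto simp: isCont_def)
  then have "(g \<longlongrightarrow> f w) (at w)"
    using assms(1) by (metis Lim_transform_eventually)
  then show ?thesis
    using g tendsto_unique[OF _ _ g] by (simp add: trivial_limit_at)
qed

text \<open>A property that holds off a sparse set holds along an affine line close to any of its points, except
possibly at that point; the lines are used both to perturb parameters and to prove density.\<close>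

lemma eventually_at_affine:
  fixes w k :: complex
  assumes "eventually P (cosparse UNIV)" and "k \<noteq> 0"
  shows "eventually (\<lambda>\<tau>. P (w + \<tau> * k)) (at 0)"
proof -
  have "eventually P (at w)"
    using assms(1) by (simp add: eventually_cosparse_open_eq)
  moreover have "filterlim (\<lambda>\<tau>. w + \<tau> * k) (at w) (at 0)"
    unfolding filterlim_at using assms(2)
    by (auto intro!: tendsto_eq_intros eventually_at_in_open' eventually_neq_at_within simp: eventually_at_filter)
  ultimately show ?thesis
    by (simp add: filterlim_iff)
qed

lemma open_Collect_all_finite:
  fixes P :: "'i::finite \<Rightarrow> 'a::topological_space \<Rightarrow> bool"
  assumes "\<And>i. open {z. P i z}"
  shows "open {z. \<forall>i. P i z}"
  using assms unfolding Collect_all_eq by auto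

lemma analytic_on_insert_iff: "G analytic_on insert a A \<longleftrightarrow> G analytic_on {a} \<and> G analytic_on A"
  by (metis analytic_on_Un insert_is_Un)

section \<open>Partial fractions from the Riemann relation\<close>

lemma sum_UNIV_Plus: "(\<Sum>a\<in>UNIV. f a) = (\<Sum>i\<in>UNIV. f (Inl i)) + (\<Sum>l\<in>UNIV. f (Inr l))"
  for f :: "'m::finite + 'n::finite \<Rightarrow> 'a::comm_monoid_add"
  using sum.Plus[of UNIV UNIV f] by simp

lemma prod_UNIV_Plus: "(\<Prod>a\<in>UNIV. f a) = (\<Prod>i\<in>UNIV. f (Inl i)) * (\<Prod>l\<in>UNIV. f (Inr l))"
  for f :: "'m::finite + 'n::finite \<Rightarrow> 'a::comm_monoid_mult"
  using prod.Plus[of UNIV UNIV f] by simp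

locale riemann_function =
  fixes s :: "complex \<Rightarrow> complex"
  assumes holomorphic: "s holomorphic_on UNIV"
    and nonzero: "\<exists>u. s u \<noteq> 0"
    and riemann: "riemann_relation s"
begin

lemma relation:
  "s (x + u) * s (x - u) * s (y + v) * s (y - v) - s (x + v) * s (x - v) * s (y + u) * s (y - u)
    = s (x + y) * s (x - y) * s (u + v) * s (u - v)"
  using riemann unfolding riemann_relation_def by blast

text \<open>Exchanging \<open>u\<close> and \<open>v\<close> negates the left-hand side of the Riemann relation, hence the factor
\<open>s (u - v)\<close> on the right must change sign, provided that the other three factors do not vanish. The
arguments are chosen so that these three are all equal to \<open>s w\<close>.\<close>

lemma odd: "s (- z) = - s z"
proof -
  obtain w where w: "s w \<noteq> 0" using nonzero by blast
  have "s w * s w * s w * (s z + s (- z)) = 0"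
  proof -
    define p q where "p = (w + z) / 2" and "q = (w - z) / 2"
    have e: "p + q = w" "q + p = w" "p - q = z" "q - p = - z"
      unfolding p_def q_def by (simp_all add: field_simps)
    show ?thesis
      using relation[of w p 0 q] relation[of w q 0 p] unfolding e
      by (simp add: algebra_simps) (metis add.right_inverse)
  qed
  then show ?thesis
    using w by (simp add: add_eq_0_iff)
qed

lemma odd_quotient: "s (- a) / s (- b) = s a / s b"
  by (simp add: odd)

lemma zero [simp]: "s 0 = 0"
  using odd[of 0] by simp

lemma odd_diff: "s (a - b) = - s (b - a)"
  using odd[of "b - a"] by simp

lemma isCont: "isCont s z"
  using holomorphic holomorphic_on_imp_continuous_on continuous_on_eq_continuous_at open_UNIV by blast

lemma tendsto [tendsto_intros]: "(f \<longlongrightarrow> l) F \<Longrightarrow> ((\<lambda>x. s (f x)) \<longlongrightarrow> s l) F"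
  using isCont isCont_tendsto_compose by blast

lemma continuous_comp: "continuous_on A f \<Longrightarrow> continuous_on A (\<lambda>x. s (f x))"
  using isCont by (simp add: continuous_on tendsto)

text \<open>An entire function that vanishes on more than a sparse set vanishes almost everywhere, hence
everywhere by continuity.\<close>

lemma nonzero_cosparse: "\<forall>\<^sub>\<approx>z\<in>UNIV. s z \<noteq> 0"
proof -
  have "s meromorphic_on UNIV"
    using holomorphic by (simp add: analytic_on_imp_meromorphic_on analytic_on_open)
  moreover have "\<not> (\<forall>\<^sub>\<approx>z\<in>UNIV. s z = 0)"
  proof
    assume "\<forall>\<^sub>\<approx>z\<in>UNIV. s z = 0"
    then have "s z = 0" for z
      using isCont_eq_if_eventually_eq_at[of s "\<lambda>_. 0" z] isCont
      by (simp add: eventually_cosparse_open_eq)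
    then show False using nonzero by blast
  qed
  ultimately show ?thesis
    using meromorphic_imp_constant_or_avoid[of s UNIV 0] by auto
qed

text \<open>The Riemann relation, rearranged as the partial fraction expansion in \<open>t\<close> of the product of
\<open>s (t - a + D) / s (t - a)\<close> and \<open>s (t - v) / s (t - u)\<close>, with denominators cleared. Adding the second
factor changes the shift \<open>D\<close> to \<open>D + u - v\<close>.\<close>

lemma three_term:
  "s (D + u - v) * s (t - v) * s (t - a + D) * s (u - a)
    = s (t - a) * s (u - v) * s (u - a + D) * s (t - u + (D + u - v))
      - s (t - u) * s (a - v) * s D * s (t - a + (D + u - v))"
proof -
  \<comment> \<open>\<open>X\<close>, \<open>Y\<close>, \<open>U\<close>, \<open>V\<close> solve the linear system \<open>X + Y = t - a + D\<close>, \<open>X - Y = t - v\<close>,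
    \<open>U + V = D + u - v\<close>, \<open>U - V = u - a\<close>.\<close>
  define X where "X = t - a / 2 + D / 2 - v / 2"
  define Y where "Y = (D + v - a) / 2"
  define U where "U = (D - v - a) / 2 + u"
  define V where "V = (D - v + a) / 2"
  have e: "X + U = t - a + (D + u - v)" "X - U = t - u" "Y + V = D" "Y - V = v - a"
    "X + V = t - u + (D + u - v)" "X - V = t - a" "Y + U = u - a + D" "Y - U = v - u"
    "X + Y = t - a + D" "X - Y = t - v" "U + V = D + u - v" "U - V = u - a"
    unfolding X_def Y_def U_def V_def by (simp_all add: field_simps)
  show ?thesis
    using relation[of X U Y V] unfolding e odd_diff[of v a] odd_diff[of v u]
    by (simp add: algebra_simps)
qed

text \<open>The induction step from \<open>A\<close> to \<open>insert x A\<close>. Multiplying the expansion for \<open>A\<close> by the new factor and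
applying \<open>three_term\<close> to each summand gives the right coefficient at every old point. The
contributions to the new point \<open>u x\<close> add up to the expansion for \<open>A\<close> evaluated at \<open>t = u x\<close>, which is the
product that the coefficient at \<open>u x\<close> requires. Since \<open>s (D A)\<close> appears as a common factor, it
must be nonzero to be cancelled.\<close>

lemma interpolation_step:
  fixes u v :: "'i \<Rightarrow> complex"
  defines "D \<equiv> \<lambda>A. (\<Sum>b\<in>A. u b) - (\<Sum>b\<in>A. v b)"
    and "c \<equiv> \<lambda>A a. (\<Prod>b\<in>A. s (u a - v b)) / (\<Prod>b\<in>A-{a}. s (u a - u b))"
  assumes A: "finite A" "x \<notin> A"
    and IH: "\<And>t. \<forall>b\<in>A. s (t - u b) \<noteq> 0 \<Longrightarrow>
      s (D A) * (\<Prod>b\<in>A. s (t - v b) / s (t - u b)) = (\<Sum>a\<in>A. s (t - u a + D A) / s (t - u a) * c A a)"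
    and nz: "s (D A) \<noteq> 0"
    and distinct: "\<forall>b\<in>A. s (u x - u b) \<noteq> 0"
    and t: "\<forall>b\<in>insert x A. s (t - u b) \<noteq> 0"
  shows "s (D (insert x A)) * (\<Prod>b\<in>insert x A. s (t - v b) / s (t - u b))
     = (\<Sum>a\<in>insert x A. s (t - u a + D (insert x A)) / s (t - u a) * c (insert x A) a)"
proof -
  define E where "E = D (insert x A)"
  have E: "E = D A + u x - v x"
    unfolding E_def D_def using A by simp
  define F where "F z = (\<Prod>b\<in>A. s (z - v b) / s (z - u b))" for z
  have c_new: "c (insert x A) x = s (u x - v x) * F (u x)"
    unfolding c_def F_def using A by (simp add: prod_dividef)
  have c_old: "c (insert x A) a = s (u a - v x) / s (u a - u x) * c A a" if "a \<in> A" for a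
  proof -
    have "insert x A - {a} = insert x (A - {a})" using that A by auto
    then show ?thesis unfolding c_def using A by simp
  qed
  have split_term: "s E * s (t - v x) / s (t - u x) * (s (t - u a + D A) / s (t - u a))
      = s (D A) * (s (t - u a + E) / s (t - u a) * (s (u a - v x) / s (u a - u x)))
        + s (t - u x + E) / s (t - u x) * s (u x - v x) * (s (u x - u a + D A) / s (u x - u a))"
    if "a \<in> A" for a
  proof -
    have nz': "s (t - u a) \<noteq> 0" "s (t - u x) \<noteq> 0" "s (u x - u a) \<noteq> 0"
      using that t distinct by auto
    show ?thesis
      unfolding odd_diff[of "u a" "u x"]
      using three_term[of "D A" "u x" "v x" t "u a"] nz'
      unfolding E[symmetric] by (simp add: field_simps)
  qed
  have "s (D A) * (s E * (s (t - v x) / s (t - u x) * F t))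
      = s E * s (t - v x) / s (t - u x) * (s (D A) * F t)" by simp
  also have "\<dots> = (\<Sum>a\<in>A. (s E * s (t - v x) / s (t - u x) * (s (t - u a + D A) / s (t - u a))) * c A a)"
    using IH[of t] t unfolding F_def by (simp add: sum_distrib_left algebra_simps)
  also have "\<dots> = (\<Sum>a\<in>A. s (D A) * (s (t - u a + E) / s (t - u a) * c (insert x A) a)
      + s (t - u x + E) / s (t - u x) * s (u x - v x) * (s (u x - u a + D A) / s (u x - u a) * c A a))"
    by (intro sum.cong refl) (simp only: split_term c_old distrib_right mult.assoc)
  \<comment> \<open>The induction hypothesis is used a second time, now at the point \<open>u x\<close>.\<close>
  also have "\<dots> = s (D A) * (\<Sum>a\<in>A. s (t - u a + E) / s (t - u a) * c (insert x A) a)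
      + s (t - u x + E) / s (t - u x) * s (u x - v x) * (s (D A) * F (u x))"
    using IH[of "u x"] distinct unfolding F_def by (simp add: sum.distrib sum_distrib_left)
  also have "\<dots> = s (D A) * (\<Sum>a\<in>insert x A. s (t - u a + E) / s (t - u a) * c (insert x A) a)"
    using A c_new by (simp add: algebra_simps)
  finally have "s E * (s (t - v x) / s (t - u x) * F t)
      = (\<Sum>a\<in>insert x A. s (t - u a + E) / s (t - u a) * c (insert x A) a)"
    using nz mult_left_cancel by blast
  then show ?thesis
    unfolding E_def F_def using A by simp
qed

text \<open>Lagrange interpolation for \<open>s\<close>. For \<open>s u = u\<close> the left-hand side is \<open>D\<close> times a rational function that
tends to \<open>1\<close> at infinity, and the formula is a form of its partial fraction decomposition. In the
induction, a zero of \<open>s (D A)\<close> is avoided by moving a little of \<open>v\<close> from the new point to an old one: this changes the sum over \<open>A\<close>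
but leaves the sum over \<open>insert x A\<close>, and hence the shift in the new expansion, as it is.\<close>

lemma interpolation:
  fixes u v :: "'i \<Rightarrow> complex"
  assumes "finite A" "A \<noteq> {}"
    and "\<And>a b. a \<in> A \<Longrightarrow> b \<in> A \<Longrightarrow> a \<noteq> b \<Longrightarrow> s (u a - u b) \<noteq> 0"
    and "\<forall>b\<in>A. s (t - u b) \<noteq> 0"
  shows "s (sum u A - sum v A) * (\<Prod>b\<in>A. s (t - v b) / s (t - u b))
     = (\<Sum>a\<in>A. s (t - u a + (sum u A - sum v A)) / s (t - u a)
          * ((\<Prod>b\<in>A. s (u a - v b)) / (\<Prod>b\<in>A-{a}. s (u a - u b))))"
  using assms
proof (induction A arbitrary: v t rule: finite_ne_induct)
  case (singleton x)
  then show ?case by simp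
next
  case (insert x A)
  \<comment> \<open>\<open>k\<close> is \<open>1\<close> at one old point, \<open>- 1\<close> at the new point and \<open>0\<close> elsewhere.\<close>
  obtain k :: "'i \<Rightarrow> complex" where k: "sum k A = 1" "sum k (insert x A) = 0"
  proof -
    obtain p where "p \<in> A" using insert by auto
    then show ?thesis
      using that[of "\<lambda>b. of_bool (b = p) - of_bool (b = x)"] insert(1,3)
      by (auto simp: sum_subtractf of_bool_def)
  qed
  define w where "w \<epsilon> b = v b + \<epsilon> * k b" for \<epsilon> b
  have sum_w: "sum (w \<epsilon>) B = sum v B + \<epsilon> * sum k B" for \<epsilon> B
    by (simp add: w_def sum.distrib sum_distrib_left)
  define E where "E = sum u (insert x A) - sum v (insert x A)"
  have E: "sum u (insert x A) - sum (w \<epsilon>) (insert x A) = E" for \<epsilon>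
    using k by (simp only: sum_w E_def) simp
  have "\<forall>\<^sub>F \<epsilon> in at 0. s (sum u A - sum (w \<epsilon>) A) \<noteq> 0"
    using eventually_at_affine[OF nonzero_cosparse, of "-1" "sum u A - sum v A"]
    by (simp add: sum_w k algebra_simps)
  then have ev: "\<forall>\<^sub>F \<epsilon> in at 0. s E * (\<Prod>b\<in>insert x A. s (t - w \<epsilon> b) / s (t - u b))
     = (\<Sum>a\<in>insert x A. s (t - u a + E) / s (t - u a)
          * ((\<Prod>b\<in>insert x A. s (u a - w \<epsilon> b)) / (\<Prod>b\<in>insert x A-{a}. s (u a - u b))))"
  proof eventually_elim
    case (elim \<epsilon>)
    show ?case
      by (rule interpolation_step[of A x u "w \<epsilon>" t, unfolded E])
        (use insert elim in \<open>auto\<close>)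
  qed
  have w_tendsto: "((\<lambda>\<epsilon>. w \<epsilon> b) \<longlongrightarrow> w 0 b) (at 0)" for b
    unfolding w_def by (intro tendsto_intros)
  have "s E * (\<Prod>b\<in>insert x A. s (t - w 0 b) / s (t - u b))
     = (\<Sum>a\<in>insert x A. s (t - u a + E) / s (t - u a)
          * ((\<Prod>b\<in>insert x A. s (u a - w 0 b)) / (\<Prod>b\<in>insert x A-{a}. s (u a - u b))))"
    by (rule isCont_eq_if_eventually_eq_at[OF ev]; unfold isCont_def)
      (use insert in \<open>intro tendsto_intros w_tendsto; auto\<close>)+
  then show ?case
    by (simp only: w_def E_def) simp
qed

text \<open>The interpolation formula for all points but \<open>u x\<close>, evaluated at \<open>t = u x\<close>: by the balancing condition its
shift is \<open>D = v x - u x\<close>, so that \<open>s (t - u a + D) = s (v x - u a)\<close> supplies the missing factor of the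
numerator, and the left-hand side is up to sign the summand that belongs to \<open>u x\<close>.\<close>

lemma partial_fraction:
  fixes u v :: "'i \<Rightarrow> complex"
  assumes "finite A"
    and "\<And>a b. a \<in> A \<Longrightarrow> b \<in> A \<Longrightarrow> a \<noteq> b \<Longrightarrow> s (u a - u b) \<noteq> 0"
    and "sum u A = sum v A"
  shows "(\<Sum>a\<in>A. (\<Prod>b\<in>A. s (u a - v b)) / (\<Prod>b\<in>A-{a}. s (u a - u b))) = 0"
proof (cases "\<exists>x B. A = insert x B \<and> x \<notin> B \<and> B \<noteq> {}")
  case False
  then have "A = {} \<or> (\<exists>x. A = {x})"
    by (metis all_not_in_conv insertE insertI1 mk_disjoint_insert)
  then show ?thesis
    using assms(3) by auto
next
  case True
  then obtain x B where A: "A = insert x B" "x \<notin> B" "B \<noteq> {}" by blast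
  have fin: "finite B" using assms(1) A by simp
  have D: "sum u B - sum v B = v x - u x"
    using assms(3) A fin by (simp add: algebra_simps)
  have nz: "\<forall>b\<in>B. s (u x - u b) \<noteq> 0"
    using assms(2) A by auto
  have eq: "s (v x - u x) * (\<Prod>b\<in>B. s (u x - v b) / s (u x - u b))
     = (\<Sum>a\<in>B. s (v x - u a) / s (u x - u a)
          * ((\<Prod>b\<in>B. s (u a - v b)) / (\<Prod>b\<in>B-{a}. s (u a - u b))))"
    using interpolation[OF fin A(3), of u "u x" v] assms(2) A nz unfolding D by simp
  have old: "(\<Prod>b\<in>A. s (u a - v b)) / (\<Prod>b\<in>A-{a}. s (u a - u b)) = s (v x - u a) / s (u x - u a)
          * ((\<Prod>b\<in>B. s (u a - v b)) / (\<Prod>b\<in>B-{a}. s (u a - u b)))" if "a \<in> B" for a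
  proof -
    have "A - {a} = insert x (B - {a})" using that A by auto
    then show ?thesis
      using A fin by (simp add: odd_diff[of "u a" "v x"] odd_diff[of "u a" "u x"])
  qed
  have "(\<Prod>b\<in>A. s (u x - v b)) / (\<Prod>b\<in>A-{x}. s (u x - u b))
      = s (u x - v x) * (\<Prod>b\<in>B. s (u x - v b) / s (u x - u b))"
    using A fin by (simp add: prod_dividef)
  also have "\<dots> = - (\<Sum>a\<in>B. (\<Prod>b\<in>A. s (u a - v b)) / (\<Prod>b\<in>A-{a}. s (u a - u b)))"
    using eq old by (simp add: odd_diff[of "u x" "v x"])
  finally show ?thesis
    using A fin by simp
qed

text \<open>The partial fraction formula for the points \<open>x\<^sub>i\<close> and \<open>z\<^sub>l\<close> together, with zeros at \<open>x\<^sub>i - \<kappa>\<close> and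
\<open>z\<^sub>l - \<delta>\<close>. The factors \<open>s \<kappa>\<close> and \<open>s \<delta>\<close> come from each point and its own displacement.\<close>

lemma two_block_identity:
  fixes x :: "'m::finite \<Rightarrow> complex" and z :: "'n::finite \<Rightarrow> complex"
  assumes "\<And>i j. i \<noteq> j \<Longrightarrow> s (x i - x j) \<noteq> 0" and "\<And>k l. k \<noteq> l \<Longrightarrow> s (z k - z l) \<noteq> 0"
    and cross: "\<And>i l. s (x i - z l) \<noteq> 0"
    and balance: "of_nat CARD('m) * \<kappa> + of_nat CARD('n) * \<delta> = 0"
  shows "s \<kappa> * (\<Sum>i\<in>UNIV. (\<Prod>j\<in>UNIV-{i}. s (x i - x j + \<kappa>) / s (x i - x j))
              * (\<Prod>l\<in>UNIV. s (x i - z l + \<delta>) / s (x i - z l)))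
       + s \<delta> * (\<Sum>k\<in>UNIV. (\<Prod>l\<in>UNIV-{k}. s (z k - z l + \<delta>) / s (z k - z l))
              * (\<Prod>j\<in>UNIV. s (z k - x j + \<kappa>) / s (z k - x j))) = 0"
proof -
  define u where "u = case_sum x z"
  define w where "w = case_sum (\<lambda>i. x i - \<kappa>) (\<lambda>l. z l - \<delta>)"
  define C where "C a = (\<Prod>b\<in>UNIV. s (u a - w b)) / (\<Prod>b\<in>UNIV-{a}. s (u a - u b))" for a
  have "s (z l - x i) \<noteq> 0" for i l
    using cross[of i l] odd_diff[of "z l" "x i"] by simp
  then have "s (u a - u b) \<noteq> 0" if "a \<noteq> b" for a b
    using that assms(1,2) cross unfolding u_def by (cases a; cases b) auto
  moreover have "sum u UNIV = sum w UNIV"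
    using balance unfolding u_def w_def
    by (simp add: sum_UNIV_Plus sum_subtractf algebra_simps)
  ultimately have "(\<Sum>a\<in>UNIV. C a) = 0"
    unfolding C_def by (intro partial_fraction) auto
  then have total: "(\<Sum>i\<in>UNIV. C (Inl i)) + (\<Sum>k\<in>UNIV. C (Inr k)) = 0"
    by (simp add: sum_UNIV_Plus)
  have C_Inl: "C (Inl i) = s \<kappa> * ((\<Prod>j\<in>UNIV-{i}. s (x i - x j + \<kappa>) / s (x i - x j))
              * (\<Prod>l\<in>UNIV. s (x i - z l + \<delta>) / s (x i - z l)))" for i
  proof -
    have "UNIV - {Inl i :: 'm + 'n} = (UNIV - {i}) <+> UNIV"
      by (auto simp: Plus_def UNIV_sum)
    moreover have "(\<Prod>j\<in>UNIV. s (x i - x j + \<kappa>)) = s \<kappa> * (\<Prod>j\<in>UNIV-{i}. s (x i - x j + \<kappa>))"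
      by (subst prod.remove[of _ i]) auto
    ultimately show ?thesis
      unfolding C_def u_def w_def
      by (simp add: prod_UNIV_Plus prod.Plus prod_dividef algebra_simps)
  qed
  have C_Inr: "C (Inr k) = s \<delta> * ((\<Prod>l\<in>UNIV-{k}. s (z k - z l + \<delta>) / s (z k - z l))
              * (\<Prod>j\<in>UNIV. s (z k - x j + \<kappa>) / s (z k - x j)))" for k
  proof -
    have "UNIV - {Inr k :: 'm + 'n} = UNIV <+> (UNIV - {k})"
      by (auto simp: Plus_def UNIV_sum)
    moreover have "(\<Prod>l\<in>UNIV. s (z k - z l + \<delta>)) = s \<delta> * (\<Prod>l\<in>UNIV-{k}. s (z k - z l + \<delta>))"
      by (subst prod.remove[of _ k]) auto
    ultimately show ?thesis
      unfolding C_def u_def w_def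
      by (simp add: prod_UNIV_Plus prod.Plus prod_dividef algebra_simps)
  qed
  show ?thesis
    using total unfolding C_Inl C_Inr by (simp only: sum_distrib_left)
qed

end

section \<open>Ruijsenaars operators acting on product kernels\<close>

text \<open>If a shift of one variable only multiplies the kernel by a factor, the kernel can be taken out of the
difference operator, and a sum of the kind treated above remains.\<close>

lemma ruijsenaars_op_product_kernel:
  fixes x :: "complex ^ 'm" and h :: "complex \<Rightarrow> 'n::finite \<Rightarrow> complex"
  assumes "\<And>i l. h (x $ i + \<delta>) l = h (x $ i) l * q i l"
  shows "ruijsenaars_op s \<delta> \<kappa> (\<lambda>x'. \<Prod>j\<in>UNIV. \<Prod>l\<in>UNIV. h (x' $ j) l) x
    = (\<Prod>j\<in>UNIV. \<Prod>l\<in>UNIV. h (x $ j) l)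
      * (\<Sum>i\<in>UNIV. (\<Prod>j\<in>UNIV-{i}. s (x $ i - x $ j + \<kappa>) / s (x $ i - x $ j)) * (\<Prod>l\<in>UNIV. q i l))"
proof -
  have "shift_op \<delta> i (\<lambda>x'. \<Prod>j\<in>UNIV. \<Prod>l\<in>UNIV. h (x' $ j) l) x
      = (\<Prod>j\<in>UNIV. \<Prod>l\<in>UNIV. h (x $ j) l) * (\<Prod>l\<in>UNIV. q i l)" for i
  proof -
    have "(\<Prod>l\<in>UNIV. h (if j = i then x $ j + \<delta> else x $ j) l)
        = (\<Prod>l\<in>UNIV. h (x $ j) l) * (if j = i then \<Prod>l\<in>UNIV. q i l else 1)" for j
      by (simp add: assms prod.distrib)
    then show ?thesis
      by (simp add: shift_op_def prod.distrib)
  qed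
  then show ?thesis
    by (simp add: ruijsenaars_op_def sum_distrib_left mult_ac)
qed

context riemann_function
begin

text \<open>Where \<open>\<Psi>\<close> does not vanish it can be divided out, and the two-block identity for \<open>z\<^sub>l = y\<^sub>l - v\<close> remains.\<close>

lemma Psi_identity_generic:
  fixes x :: "complex ^ 'm" and y :: "complex ^ 'n"
  assumes xy: "(x, y) \<in> off_diagonals s"
    and nz: "\<And>j l. s (x $ j - y $ l + v) \<noteq> 0"
    and balance: "of_nat CARD('m) * \<kappa> + of_nat CARD('n) * \<delta> = 0"
  shows "s \<kappa> * ruijsenaars_op s \<delta> \<kappa> (\<lambda>x'. Psi_A s v x' y) x
             + s \<delta> * ruijsenaars_op s \<kappa> \<delta> (\<lambda>y'. Psi_A s v x y') y = 0"
proof -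
  define z where "z l = y $ l - v" for l
  have nz': "s (x $ j - z l) \<noteq> 0" for j l
    using nz by (simp add: z_def algebra_simps)
  have Dx: "ruijsenaars_op s \<delta> \<kappa> (\<lambda>x'. Psi_A s v x' y) x = Psi_A s v x y
      * (\<Sum>i\<in>UNIV. (\<Prod>j\<in>UNIV-{i}. s (x $ i - x $ j + \<kappa>) / s (x $ i - x $ j))
          * (\<Prod>l\<in>UNIV. s (x $ i - z l + \<delta>) / s (x $ i - z l)))"
    unfolding Psi_A_def
    by (rule ruijsenaars_op_product_kernel) (use nz' in \<open>simp add: z_def algebra_simps\<close>)
  have swap: "Psi_A s v x y' = (\<Prod>l\<in>UNIV. \<Prod>j\<in>UNIV. s (x $ j - y' $ l + v))" for y' :: "complex ^ 'n"
    unfolding Psi_A_def by (rule prod.swap)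
  have flip: "s (z k - x $ j + \<kappa>) / s (z k - x $ j) = s (x $ j - z k - \<kappa>) / s (x $ j - z k)" for j k
    using odd_quotient[of "x $ j - z k - \<kappa>" "x $ j - z k"] by (simp add: algebra_simps)
  have Dy: "ruijsenaars_op s \<kappa> \<delta> (\<lambda>y'. Psi_A s v x y') y = Psi_A s v x y
      * (\<Sum>k\<in>UNIV. (\<Prod>l\<in>UNIV-{k}. s (y $ k - y $ l + \<delta>) / s (y $ k - y $ l))
          * (\<Prod>j\<in>UNIV. s (z k - x $ j + \<kappa>) / s (z k - x $ j)))"
    unfolding swap flip
    by (rule ruijsenaars_op_product_kernel) (use nz' in \<open>simp add: z_def algebra_simps\<close>)
  have "z k - z l = y $ k - y $ l" for k l
    by (simp add: z_def)
  moreover have "s \<kappa> * (P * S) + s \<delta> * (P * T) = P * (s \<kappa> * S + s \<delta> * T)" for P S T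
    by (simp add: algebra_simps)
  ultimately show ?thesis
    using two_block_identity[of "($) x" z \<kappa> \<delta>] xy nz' balance unfolding Dx Dy off_diagonals_def
    by simp
qed

text \<open>The coefficients of the operators do not depend on \<open>v\<close>, so the left-hand side is continuous in \<open>v\<close>, even
at the points where \<open>\<Psi>\<close> vanishes.\<close>

lemma Psi_identity:
  fixes x :: "complex ^ 'm" and y :: "complex ^ 'n"
  assumes xy: "(x, y) \<in> off_diagonals s"
    and balance: "of_nat CARD('m) * \<kappa> + of_nat CARD('n) * \<delta> = 0"
  shows "s \<kappa> * ruijsenaars_op s \<delta> \<kappa> (\<lambda>x'. Psi_A s v x' y) x
             + s \<delta> * ruijsenaars_op s \<kappa> \<delta> (\<lambda>y'. Psi_A s v x y') y = 0"
    (is "?f v = 0")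
proof -
  have "\<forall>\<^sub>F \<tau> in at 0. s (x $ j - y $ l + (v + \<tau>)) \<noteq> 0" for j l
    using eventually_at_affine[OF nonzero_cosparse, of 1 "x $ j - y $ l + v"] by (simp add: add.assoc)
  then have "\<forall>\<^sub>F \<tau> in at 0. \<forall>j l. s (x $ j - y $ l + (v + \<tau>)) \<noteq> 0"
    by (intro eventually_all_finite)
  then have "\<forall>\<^sub>F \<tau> in at 0. ?f (v + \<tau>) = 0"
    by eventually_elim (use Psi_identity_generic xy balance in blast)
  moreover have "isCont (\<lambda>\<tau>. ?f (v + \<tau>)) 0"
    unfolding isCont_def ruijsenaars_op_def shift_op_def Psi_A_def
    by (intro tendsto_intros)
  ultimately show ?thesis
    using isCont_eq_if_eventually_eq_at[of "\<lambda>\<tau>. ?f (v + \<tau>)" "\<lambda>_. 0" 0] by simp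
qed

text \<open>The functional equation, which is given only almost everywhere, holds by continuity at every point
where its two sides are regular. It provides the quotients \<open>s (w - \<kappa>) / s w\<close>, in which the
constant \<open>c\<close> cancels, and also shows that their denominators do not vanish. What remains is the
two-block identity for \<open>z\<^sub>l = - y\<^sub>l - v\<close> with \<open>- \<kappa>\<close> in place of \<open>\<delta>\<close>, divided by \<open>s \<kappa>\<close>; the
sign of \<open>s (- \<kappa>)\<close> puts the two sums on opposite sides of the equation.\<close>

lemma Phi_identity:
  fixes x :: "complex ^ 'm" and y :: "complex ^ 'n"
  assumes xy: "(x, y) \<in> off_diagonals s" and reg: "(x, y) \<in> Phi_A_regular G v \<delta> \<kappa>"
    and c: "c \<noteq> 0" and G: "\<forall>\<^sub>\<approx>u\<in>UNIV. G (u + \<delta>) = c * s u * G u"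
    and card: "CARD('m) = CARD('n)" and \<kappa>: "s \<kappa> \<noteq> 0"
  shows "ruijsenaars_op s \<delta> \<kappa> (\<lambda>x'. Phi_A G v \<kappa> x' y) x
       = ruijsenaars_op s \<delta> \<kappa> (\<lambda>y'. Phi_A G v \<kappa> x y') y"
proof -
  define z where "z l = - (y $ l) - v" for l
  have functional: "G (w + \<delta>) = c * s w * G w" if "G analytic_on {w}" "G analytic_on {w + \<delta>}" for w
  proof (rule isCont_eq_if_eventually_eq_at[of "\<lambda>u. G (u + \<delta>)" "\<lambda>u. c * s u * G u" w])
    show "\<forall>\<^sub>F u in at w. G (u + \<delta>) = c * s u * G u"
      using G by (simp add: eventually_cosparse_open_eq)
    have "isCont G w" "isCont G (w + \<delta>)"
      using that by (auto intro: analytic_at_imp_isCont)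
    then show "isCont (\<lambda>u. G (u + \<delta>)) w" "isCont (\<lambda>u. c * s u * G u) w"
      by (auto intro!: continuous_intros isCont isCont_o2[of w "\<lambda>u. u + \<delta>" G])
  qed
  have w: "s w \<noteq> 0 \<and> G (w + \<delta> - \<kappa>) / G (w + \<delta>) = G (w - \<kappa>) / G w * (s (w - \<kappa>) / s w)"
    if "w = x $ j + y $ l + v" for w j l
  proof -
    have an: "G analytic_on {w, w - \<kappa>}" "G analytic_on {w + \<delta>, w + \<delta> - \<kappa>}" "G w \<noteq> 0" "G (w + \<delta>) \<noteq> 0"
      using reg that unfolding Phi_A_regular_def by auto
    then have e: "G (w + \<delta>) = c * s w * G w" "G (w + \<delta> - \<kappa>) = c * s (w - \<kappa>) * G (w - \<kappa>)"
      using functional[of w] functional[of "w - \<kappa>"]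
      by (auto simp: analytic_on_insert_iff[of G _ "{_}"] algebra_simps)
    then have "s w \<noteq> 0" using an by auto
    then show ?thesis using e c an by (simp add: mult.commute)
  qed
  have nz: "s (x $ i - z l) \<noteq> 0" for i l
    using w[OF refl, of i l] by (simp add: z_def algebra_simps)
  have Dx: "ruijsenaars_op s \<delta> \<kappa> (\<lambda>x'. Phi_A G v \<kappa> x' y) x = Phi_A G v \<kappa> x y
      * (\<Sum>i\<in>UNIV. (\<Prod>j\<in>UNIV-{i}. s (x $ i - x $ j + \<kappa>) / s (x $ i - x $ j))
          * (\<Prod>l\<in>UNIV. s (x $ i - z l + - \<kappa>) / s (x $ i - z l)))"
    unfolding Phi_A_def
    by (rule ruijsenaars_op_product_kernel)
      (use w[OF refl] in \<open>simp add: z_def algebra_simps\<close>)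
  have swap: "Phi_A G v \<kappa> x y' = (\<Prod>l\<in>UNIV. \<Prod>j\<in>UNIV. G (x $ j + y' $ l + v - \<kappa>) / G (x $ j + y' $ l + v))"
    for y' :: "complex ^ 'n"
    unfolding Phi_A_def by (rule prod.swap)
  have flip: "s (z k - x $ j + \<kappa>) / s (z k - x $ j) = s (x $ j - z k - \<kappa>) / s (x $ j - z k)" for j k
    using odd_quotient[of "x $ j - z k - \<kappa>" "x $ j - z k"] by (simp add: algebra_simps)
  have flip': "s (z k - z l + - \<kappa>) / s (z k - z l) = s (y $ k - y $ l + \<kappa>) / s (y $ k - y $ l)" for k l
    using odd_quotient[of "y $ k - y $ l + \<kappa>" "y $ k - y $ l"] by (simp add: z_def algebra_simps)
  have Dy: "ruijsenaars_op s \<delta> \<kappa> (\<lambda>y'. Phi_A G v \<kappa> x y') y = Phi_A G v \<kappa> x y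
      * (\<Sum>k\<in>UNIV. (\<Prod>l\<in>UNIV-{k}. s (z k - z l + - \<kappa>) / s (z k - z l))
          * (\<Prod>j\<in>UNIV. s (z k - x $ j + \<kappa>) / s (z k - x $ j)))"
    unfolding swap flip flip'
    by (rule ruijsenaars_op_product_kernel)
      (use w[OF refl] in \<open>simp add: z_def algebra_simps\<close>)
  have "s (z k - z l) \<noteq> 0" if "k \<noteq> l" for k l
    using xy that unfolding off_diagonals_def z_def by auto
  then show ?thesis
    using two_block_identity[of "($) x" z \<kappa> "- \<kappa>"] xy nz card \<kappa> unfolding Dx Dy off_diagonals_def
    by (simp add: odd flip: right_diff_distrib)
qed

section \<open>Openness and density of the domains\<close>

lemma open_off_diagonals: "open (off_diagonals s :: ((complex ^ 'm) \<times> (complex ^ 'n)) set)"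
proof -
  have "open {z :: (complex ^ 'm) \<times> (complex ^ 'n). i \<noteq> j \<longrightarrow> s (fst z $ i - fst z $ j) \<noteq> 0}" for i j
    by (cases "i = j") (auto intro!: open_Collect_neq continuous_comp continuous_intros)
  moreover have "open {z :: (complex ^ 'm) \<times> (complex ^ 'n). k \<noteq> l \<longrightarrow> s (snd z $ k - snd z $ l) \<noteq> 0}" for k l
    by (cases "k = l") (auto intro!: open_Collect_neq continuous_comp continuous_intros)
  ultimately have "open {z :: (complex ^ 'm) \<times> (complex ^ 'n).
      (\<forall>i j. i \<noteq> j \<longrightarrow> s (fst z $ i - fst z $ j) \<noteq> 0) \<and> (\<forall>k l. k \<noteq> l \<longrightarrow> s (snd z $ k - snd z $ l) \<noteq> 0)}"
    by (intro open_Collect_conj open_Collect_all_finite)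
  then show ?thesis
    by (simp add: off_diagonals_def case_prod_unfold)
qed

lemma eventually_distinct_on_line:
  fixes a r :: "'k::finite \<Rightarrow> complex"
  assumes "inj r"
  shows "\<forall>\<^sub>F \<tau> in at 0. \<forall>i j. i \<noteq> j \<longrightarrow> s (a i + \<tau> * r i - (a j + \<tau> * r j)) \<noteq> 0"
proof (intro eventually_all_finite)
  fix i j
  show "\<forall>\<^sub>F \<tau> in at 0. i \<noteq> j \<longrightarrow> s (a i + \<tau> * r i - (a j + \<tau> * r j)) \<noteq> 0"
    using eventually_at_affine[OF nonzero_cosparse, of "r i - r j" "a i - a j"] assms
    by (cases "i = j") (auto simp: algebra_simps inj_eq)
qed

lemma eventually_off_diagonals:
  fixes x :: "complex ^ 'm" and y :: "complex ^ 'n"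
  assumes "inj p" and "inj q"
  shows "\<forall>\<^sub>F \<tau> in at 0. (\<chi> i. x $ i + \<tau> * p i, \<chi> l. y $ l + \<tau> * q l) \<in> off_diagonals s"
  using eventually_conj[OF eventually_distinct_on_line[OF assms(1), of "($) x"]
      eventually_distinct_on_line[OF assms(2), of "($) y"]]
  by (simp add: off_diagonals_def)

end

lemma open_analytic_points: "open {w. G analytic_on {w}}"
  and analytic_on_analytic_points: "G analytic_on {w. G analytic_on {w}}"
proof -
  show *: "G analytic_on {w. G analytic_on {w}}"
    by (subst analytic_on_analytic_at) auto
  then obtain T where T: "open T" "{w. G analytic_on {w}} \<subseteq> T" "G holomorphic_on T"
    by (auto simp: analytic_on_holomorphic)
  then have "T \<subseteq> {w. G analytic_on {w}}"
    using analytic_on_open analytic_on_subset by blast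
  then show "open {w. G analytic_on {w}}" using T by auto
qed

lemma open_regular_points: "open {w. G analytic_on {w, w - \<kappa>} \<and> G w \<noteq> (0::complex)}"
proof -
  let ?T = "{w. G analytic_on {w}}"
  have "continuous_on ?T G"
    using analytic_on_analytic_points analytic_imp_holomorphic holomorphic_on_imp_continuous_on by blast
  then have "open (?T \<inter> G -` (- {0}))"
    using open_analytic_points by (intro continuous_open_preimage) auto
  moreover have "open ((\<lambda>w. w - \<kappa>) -` ?T)"
    by (intro open_vimage open_analytic_points continuous_intros)
  ultimately have "open (?T \<inter> G -` (- {0}) \<inter> (\<lambda>w. w - \<kappa>) -` ?T)" by blast
  also have "?T \<inter> G -` (- {0}) \<inter> (\<lambda>w. w - \<kappa>) -` ?T = {w. G analytic_on {w, w - \<kappa>} \<and> G w \<noteq> 0}"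
    by (auto simp: analytic_on_insert_iff[of G _ "{_}"])
  finally show ?thesis .
qed

lemma open_Phi_A_regular: "open (Phi_A_regular G v \<delta> \<kappa> :: ((complex ^ 'm) \<times> (complex ^ 'n)) set)"
proof -
  let ?S = "{w. G analytic_on {w, w - \<kappa>} \<and> G w \<noteq> 0}"
  have "open ((\<lambda>z :: (complex ^ 'm) \<times> (complex ^ 'n). fst z $ j + snd z $ l + c) -` ?S)" for j l c
    by (intro open_vimage open_regular_points continuous_intros)
  from open_Int[OF this[of _ _ v] this[of _ _ "v + \<delta>"]]
  have "open {z :: (complex ^ 'm) \<times> (complex ^ 'n).
     fst z $ j + snd z $ l + v \<in> ?S \<and> fst z $ j + snd z $ l + v + \<delta> \<in> ?S}" for j l
    by (simp add: vimage_def Collect_conj_eq[symmetric] add.assoc)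
  then have "open {z :: (complex ^ 'm) \<times> (complex ^ 'n).
     \<forall>j l. fst z $ j + snd z $ l + v \<in> ?S \<and> fst z $ j + snd z $ l + v + \<delta> \<in> ?S}"
    by (intro open_Collect_all_finite)
  then show ?thesis
    by (simp add: Phi_A_regular_def case_prod_unfold)
qed

lemma eventually_Phi_A_regular:
  fixes x :: "complex ^ 'm" and y :: "complex ^ 'n"
  assumes G: "G meromorphic_on UNIV" "\<not> (\<forall>\<^sub>\<approx>u\<in>UNIV. G u = 0)"
    and pq: "\<And>j l. p j + q l \<noteq> 0"
  shows "\<forall>\<^sub>F \<tau> in at 0. (\<chi> i. x $ i + \<tau> * p i, \<chi> l. y $ l + \<tau> * q l) \<in> Phi_A_regular G v \<delta> \<kappa>"
proof -
  have G1: "\<forall>\<^sub>\<approx>w\<in>UNIV. G analytic_on {w}"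
    using G(1) by (rule meromorphic_on_imp_analytic_cosparse)
  have G2: "\<forall>\<^sub>\<approx>w\<in>UNIV. G w \<noteq> 0"
    using meromorphic_imp_constant_or_avoid[OF G(1), of 0] G(2) by auto
  have shift: "\<forall>\<^sub>F \<tau> in at 0. P (x $ j + \<tau> * p j + (y $ l + \<tau> * q l) + c)"
    if "\<forall>\<^sub>\<approx>w\<in>UNIV. P w" for P j l c
    using eventually_at_affine[OF that pq, of "x $ j + y $ l + c" j l] by (simp add: algebra_simps)
  show ?thesis
    unfolding Phi_A_regular_def
    using shift[OF G1, of _ _ v] shift[OF G1, of _ _ "v - \<kappa>"] shift[OF G2, of _ _ v]
      shift[OF G1, of _ _ "v + \<delta>"] shift[OF G1, of _ _ "v + \<delta> - \<kappa>"] shift[OF G2, of _ _ "v + \<delta>"]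
    by (auto simp: analytic_on_insert_iff[of G _ "{_}"] add.assoc add_diff_eq
        intro!: eventually_conj eventually_all_finite)
qed

lemma tendsto_vec_line: "((\<lambda>\<tau>. \<chi> i. a $ i + \<tau> * r i) \<longlongrightarrow> (a :: complex ^ 'k)) (at 0)"
  by (rule vec_tendstoI) (auto intro!: tendsto_eq_intros)

text \<open>Every point is a limit of points of \<open>R\<close> along its line in the fixed direction \<open>(p, q)\<close>.\<close>

lemma closure_UNIV_if_eventually_on_lines:
  fixes R :: "((complex ^ 'm) \<times> (complex ^ 'n)) set"
  assumes "\<And>x y. \<forall>\<^sub>F \<tau> in at 0. (\<chi> i. x $ i + \<tau> * p i, \<chi> l. y $ l + \<tau> * q l) \<in> R"
  shows "closure R = UNIV"
proof -
  have "(x, y) \<in> closure R" for x y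
  proof (rule Lim_in_closed_set)
    show "\<forall>\<^sub>F \<tau> in at 0. (\<chi> i. x $ i + \<tau> * p i, \<chi> l. y $ l + \<tau> * q l) \<in> closure R"
      using assms[of x y] by eventually_elim (use closure_subset in blast)
    show "((\<lambda>\<tau>. (\<chi> i. x $ i + \<tau> * p i, \<chi> l. y $ l + \<tau> * q l)) \<longlongrightarrow> (x, y)) (at 0)"
      by (intro tendsto_Pair tendsto_vec_line)
  qed auto
  then show ?thesis by auto
qed

text \<open>Such functions are the coordinates of a generic direction: pairwise distinct coordinates lead away from
the diagonals, and positive ones have nonzero sums, so that no argument \<open>x\<^sub>j + y\<^sub>l\<close> stays constant
along the line.\<close>

lemma ex_inj_positive_reals: "\<exists>p :: 'i::finite \<Rightarrow> real. inj p \<and> (\<forall>i. p i > 0)"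
proof -
  obtain f :: "'i \<Rightarrow> nat" where "inj f"
    using finite_imp_inj_to_nat_seg[of "UNIV :: 'i set"] by auto
  then show ?thesis
    by (intro exI[of _ "\<lambda>i. real (Suc (f i))"]) (auto simp: inj_def)
qed

section \<open>The kernel function identities of type A\<close>

theorem theorem2p1:
  fixes s :: "complex \<Rightarrow> complex" and \<Omega> :: "complex set" and \<delta> \<kappa> v :: complex
  assumes "s holomorphic_on UNIV" and "\<exists>u. s u \<noteq> 0" and "riemann_relation s"
    and "\<Omega> = {u. s u = 0}" and "\<delta> \<notin> \<Omega>" and "\<kappa> \<notin> \<Omega>"
  shows
    "(\<forall>G c. G meromorphic_on UNIV \<and> \<not> (\<forall>\<^sub>\<approx>u\<in>UNIV. G u = 0) \<and>
        c \<noteq> 0 \<and> (\<forall>\<^sub>\<approx>u\<in>UNIV. G (u + \<delta>) = c * s u * G u) \<and> CARD('m) = CARD('n) \<longrightarrow>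
        meromorphic_eq_on (off_diagonals s \<inter> Phi_A_regular G v \<delta> \<kappa>)
          (\<lambda>(x :: complex ^ 'm, y :: complex ^ 'n).
             ruijsenaars_op s \<delta> \<kappa> (\<lambda>x'. Phi_A G v \<kappa> x' y) x)
          (\<lambda>(x, y). ruijsenaars_op s \<delta> \<kappa> (\<lambda>y'. Phi_A G v \<kappa> x y') y))
     \<and>
     (of_nat CARD('m) * \<kappa> + of_nat CARD('n) * \<delta> = 0 \<longrightarrow>
        meromorphic_eq_on (off_diagonals s)
          (\<lambda>(x :: complex ^ 'm, y :: complex ^ 'n).
             s \<kappa> * ruijsenaars_op s \<delta> \<kappa> (\<lambda>x'. Psi_A s v x' y) x
             + s \<delta> * ruijsenaars_op s \<kappa> \<delta> (\<lambda>y'. Psi_A s v x y') y)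
          (\<lambda>_. 0))"
proof -
  interpret riemann_function s
    using assms by unfold_locales auto
  obtain p :: "'m \<Rightarrow> real" and q :: "'n \<Rightarrow> real"
    where p: "inj p" "\<forall>i. p i > 0" and q: "inj q" "\<forall>l. q l > 0"
    using ex_inj_positive_reals by metis
  have inj: "inj (\<lambda>i. complex_of_real (p i))" "inj (\<lambda>l. complex_of_real (q l))"
    using p q by (auto simp: inj_def)
  have pos: "complex_of_real (p i) + complex_of_real (q l) \<noteq> 0" for i l
    using p(2) q(2) add_pos_pos[of "p i" "q l"]
    by (metis of_real_add of_real_eq_0_iff less_irrefl)
  show ?thesis
  proof (intro conjI allI impI; (elim conjE)?)
    fix G :: "complex \<Rightarrow> complex" and c
    assume G: "G meromorphic_on UNIV" "\<not> (\<forall>\<^sub>\<approx>u\<in>UNIV. G u = 0)"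
      and *: "c \<noteq> 0" "\<forall>\<^sub>\<approx>u\<in>UNIV. G (u + \<delta>) = c * s u * G u" "CARD('m) = CARD('n)"
    have "closure (off_diagonals s \<inter> Phi_A_regular G v \<delta> \<kappa> :: ((complex ^ 'm) \<times> (complex ^ 'n)) set) = UNIV"
      using eventually_off_diagonals[OF inj] eventually_Phi_A_regular[OF G pos]
      by (intro closure_UNIV_if_eventually_on_lines[where p = "\<lambda>i. of_real (p i)" and q = "\<lambda>l. of_real (q l)"])
        (simp add: eventually_conj_iff)
    then show "meromorphic_eq_on (off_diagonals s \<inter> Phi_A_regular G v \<delta> \<kappa>)
          (\<lambda>(x :: complex ^ 'm, y :: complex ^ 'n).
             ruijsenaars_op s \<delta> \<kappa> (\<lambda>x'. Phi_A G v \<kappa> x' y) x)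
          (\<lambda>(x, y). ruijsenaars_op s \<delta> \<kappa> (\<lambda>y'. Phi_A G v \<kappa> x y') y)"
      unfolding meromorphic_eq_on_def
      using open_Int[OF open_off_diagonals open_Phi_A_regular] Phi_identity * assms(4,6) by auto
  next
    assume balance: "of_nat CARD('m) * \<kappa> + of_nat CARD('n) * \<delta> = 0"
    have "closure (off_diagonals s :: ((complex ^ 'm) \<times> (complex ^ 'n)) set) = UNIV"
      using eventually_off_diagonals[OF inj] by (intro closure_UNIV_if_eventually_on_lines)
    then show "meromorphic_eq_on (off_diagonals s)
          (\<lambda>(x :: complex ^ 'm, y :: complex ^ 'n).
             s \<kappa> * ruijsenaars_op s \<delta> \<kappa> (\<lambda>x'. Psi_A s v x' y) x
             + s \<delta> * ruijsenaars_op s \<kappa> \<delta> (\<lambda>y'. Psi_A s v x y') y)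
          (\<lambda>_. 0)"
      unfolding meromorphic_eq_on_def
      using open_off_diagonals Psi_identity balance by auto
  qed
qed

end
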